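(* Let $\Omega\subset\mathbb{C}$ be an exceptional domain with finite connectivity (i.e. $\partial\Omega$ has finitely many connected components) which is not a half-plane, and let $u$ be its associated function. Then $|\nabla u|<1$ everywhere in $\Omega$.
   Context: We identify $\mathbb{R}^2$ with $\mathbb{C}$, writing $z=x+iy$. An open set $\Omega\subset\mathbb{C}$ with non-empty boundary is a smooth domain if, for each $z_0\in\partial\Omega$, there exist $\varepsilon>0$ and a smooth diffeomorphism $\psi$ from $D(z_0,\varepsilon)$ onto an open set $D\subset\mathbb{R}^2$ such that $\psi(D(z_0,\varepsilon)\cap\Omega)=D\cap\{x_2>0\}$ and $\psi(D(z_0,\varepsilon)\cap\partial\Omega)=D\cap\{x_2=0\}$. An exceptional domain is a smooth, connected, unbounded domain $\Omega\subset\mathbb{C}$ with non-empty boundary that admits a function $u$, harmonic in $\Omega$ and $C^1$ up to the boundary, such that $u>0$ in $\Omega$, $u=0$ on $\partial\Omega$, and $|\nabla u|=1$ on $\partial\Omega$. Such a $u$ is unique, and we call it the associated function of $\Omega$. *)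

theory Defs
  imports "HOL-Analysis.Analysis"
begin

text \<open>We identify R^2 with the complex plane.  Partial derivatives are indexed by
lists of directions: True = derivative in the x-direction (direction 1),
False = derivative in the y-direction (direction i).  D ds is the iterated
partial derivative, first applying the last element of ds.\<close>

definition Ck_on :: "nat \<Rightarrow> complex set \<Rightarrow> (complex \<Rightarrow> 'a::real_normed_vector) \<Rightarrow> bool" where
  "Ck_on k S f \<longleftrightarrow> open S \<and>
     (\<exists>D :: bool list \<Rightarrow> complex \<Rightarrow> 'a.
        (\<forall>x\<in>S. D [] x = f x) \<and>
        (\<forall>ds. length ds \<le> k \<longrightarrow> continuous_on S (D ds)) \<and>
        (\<forall>ds. length ds < k \<longrightarrow> (\<forall>x\<in>S.
            (D ds has_derivative (\<lambda>h. Re h *\<^sub>R D (True # ds) x + Im h *\<^sub>R D (False # ds) x)) (at x))))"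

definition smooth_on :: "complex set \<Rightarrow> (complex \<Rightarrow> 'a::real_normed_vector) \<Rightarrow> bool" where
  "smooth_on S f \<longleftrightarrow> (\<forall>k. Ck_on k S f)"

definition smooth_diffeo :: "complex set \<Rightarrow> (complex \<Rightarrow> complex) \<Rightarrow> complex set \<Rightarrow> bool" where
  "smooth_diffeo U \<psi> V \<longleftrightarrow> open U \<and> open V \<and> bij_betw \<psi> U V \<and> smooth_on U \<psi> \<and>
     (\<exists>\<phi>. smooth_on V \<phi> \<and> (\<forall>x\<in>U. \<phi> (\<psi> x) = x))"

definition smooth_domain :: "complex set \<Rightarrow> bool" where
  "smooth_domain \<Omega> \<longleftrightarrow> open \<Omega> \<and> frontier \<Omega> \<noteq> {} \<and>
     (\<forall>z0\<in>frontier \<Omega>. \<exists>\<epsilon>>0. \<exists>\<psi> D. smooth_diffeo (ball z0 \<epsilon>) \<psi> D \<and>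
        \<psi> ` (ball z0 \<epsilon> \<inter> \<Omega>) = D \<inter> {x. Im x > 0} \<and>
        \<psi> ` (ball z0 \<epsilon> \<inter> frontier \<Omega>) = D \<inter> {x. Im x = 0})"

definition harmonic_on :: "complex set \<Rightarrow> (complex \<Rightarrow> real) \<Rightarrow> bool" where
  "harmonic_on S u \<longleftrightarrow> open S \<and>
     (\<exists>D :: bool list \<Rightarrow> complex \<Rightarrow> real.
        (\<forall>x\<in>S. D [] x = u x) \<and>
        (\<forall>ds. length ds \<le> 2 \<longrightarrow> continuous_on S (D ds)) \<and>
        (\<forall>ds. length ds < 2 \<longrightarrow> (\<forall>x\<in>S.
            (D ds has_derivative (\<lambda>h. Re h *\<^sub>R D (True # ds) x + Im h *\<^sub>R D (False # ds) x)) (at x))) \<and>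
        (\<forall>x\<in>S. D [True, True] x + D [False, False] x = 0))"

definition associated_function :: "complex set \<Rightarrow> (complex \<Rightarrow> real) \<Rightarrow> bool" where
  "associated_function \<Omega> u \<longleftrightarrow>
     harmonic_on \<Omega> u \<and> Ck_on 1 \<Omega> u \<and> continuous_on (closure \<Omega>) u \<and>
     (\<exists>G :: complex \<Rightarrow> complex. continuous_on (closure \<Omega>) G \<and>
        (\<forall>z\<in>\<Omega>. (u has_derivative (\<lambda>h. G z \<bullet> h)) (at z)) \<and>
        (\<forall>z\<in>frontier \<Omega>. norm (G z) = 1)) \<and>
     (\<forall>z\<in>\<Omega>. u z > 0) \<and> (\<forall>z\<in>frontier \<Omega>. u z = 0)"

definition exceptional_domain :: "complex set \<Rightarrow> bool" where
  "exceptional_domain \<Omega> \<longleftrightarrow> smooth_domain \<Omega> \<and> connected \<Omega> \<and> \<not> bounded \<Omega> \<and>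
     frontier \<Omega> \<noteq> {} \<and> (\<exists>u. associated_function \<Omega> u)"

definition half_plane :: "complex set \<Rightarrow> bool" where
  "half_plane H \<longleftrightarrow> (\<exists>b c. b \<noteq> 0 \<and> H = {z. b \<bullet> z > c})"

end

theory Submission
  imports Defs "HOL-Complex_Analysis.Complex_Analysis"
begin

text \<open>The conjugate \<open>f\<close> of the gradient of \<open>u\<close> is holomorphic in \<open>\<Omega>\<close>, with \<open>|f| = 1\<close> on the
  boundary.  It is bounded: comparing \<open>u\<close> near the boundary with its value at the centre of a
  disc touching the boundary shows that \<open>u\<close> grows at most linearly with the distance to the
  boundary, so the gradient estimate for positive harmonic functions gives \<open>|f| \<le> 4\<close>.  Since
  the complement of \<open>\<Omega>\<close> has interior points, a Phragmen-Lindelof argument improves this to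
  \<open>|f| \<le> 1\<close>, and if equality holds at an interior point then \<open>f\<close> is constant, \<open>u\<close> is affine and
  \<open>\<Omega>\<close> is a half-plane.\<close>

section \<open>Symmetry of second partial derivatives\<close>

text \<open>Two mean value steps: first for the \<open>q\<close>-increment of \<open>u\<close> as a
  function of \<open>s\<close>, whose derivative is a difference of values of \<open>A\<close>, then
  for \<open>A\<close> in direction \<open>q\<close>. Arbitrary directions allow both orders of
  differentiation.\<close>

lemma second_difference_mvt:
  fixes u A B :: "'a::real_normed_vector \<Rightarrow> real"
  assumes "0 < h"
    and u: "\<And>s t. 0 \<le> s \<Longrightarrow> s \<le> h \<Longrightarrow> 0 \<le> t \<Longrightarrow> t \<le> h \<Longrightarrow>
      ((\<lambda>s. u (x + s *\<^sub>R p + t *\<^sub>R q)) has_real_derivative A (x + s *\<^sub>R p + t *\<^sub>R q)) (at s)"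
    and A: "\<And>s t. 0 \<le> s \<Longrightarrow> s \<le> h \<Longrightarrow> 0 \<le> t \<Longrightarrow> t \<le> h \<Longrightarrow>
      ((\<lambda>t. A (x + s *\<^sub>R p + t *\<^sub>R q)) has_real_derivative B (x + s *\<^sub>R p + t *\<^sub>R q)) (at t)"
  obtains s t where "0 < s" "s < h" "0 < t" "t < h"
    "u (x + h *\<^sub>R p + h *\<^sub>R q) - u (x + h *\<^sub>R p) - u (x + h *\<^sub>R q) + u x
      = h * h * B (x + s *\<^sub>R p + t *\<^sub>R q)"
proof -
  have "\<exists>s>0. s < h \<and>
      (u (x + h *\<^sub>R p + h *\<^sub>R q) - u (x + h *\<^sub>R p + 0 *\<^sub>R q))
      - (u (x + 0 *\<^sub>R p + h *\<^sub>R q) - u (x + 0 *\<^sub>R p + 0 *\<^sub>R q))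
      = (h - 0) * (A (x + s *\<^sub>R p + h *\<^sub>R q) - A (x + s *\<^sub>R p + 0 *\<^sub>R q))"
    by (rule MVT2[OF \<open>0 < h\<close>]) (intro DERIV_diff u; use \<open>0 < h\<close> in simp)
  then obtain s where s: "0 < s" "s < h" and es:
    "(u (x + h *\<^sub>R p + h *\<^sub>R q) - u (x + h *\<^sub>R p)) - (u (x + h *\<^sub>R q) - u x)
      = h * (A (x + s *\<^sub>R p + h *\<^sub>R q) - A (x + s *\<^sub>R p))"
    by auto
  have "\<exists>t>0. t < h \<and> A (x + s *\<^sub>R p + h *\<^sub>R q) - A (x + s *\<^sub>R p + 0 *\<^sub>R q)
      = (h - 0) * B (x + s *\<^sub>R p + t *\<^sub>R q)"
    by (rule MVT2[OF \<open>0 < h\<close>]) (intro A; use s in simp)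
  then obtain t where "0 < t" "t < h"
      "A (x + s *\<^sub>R p + h *\<^sub>R q) - A (x + s *\<^sub>R p) = h * B (x + s *\<^sub>R p + t *\<^sub>R q)"
    by auto
  with s es show ?thesis
    by (intro that[of s t]) auto
qed

lemma has_derivative_along_line:
  assumes "(f has_derivative f') (at (x + s *\<^sub>R p))"
  shows "((\<lambda>s. f (x + s *\<^sub>R p)) has_real_derivative f' p) (at s)"
proof -
  have "((\<lambda>s. x + s *\<^sub>R p) has_derivative (\<lambda>h. h *\<^sub>R p)) (at s)"
    by (auto intro!: derivative_eq_intros)
  from has_derivative_compose[OF this assms]
  have "((\<lambda>s. f (x + s *\<^sub>R p)) has_derivative (\<lambda>h. f' (h *\<^sub>R p))) (at s)" .
  moreover have "(\<lambda>h. f' (h *\<^sub>R p)) = (*) (f' p)"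
    using linear_scale[OF has_derivative_linear[OF assms]] by (auto simp: mult.commute)
  ultimately show ?thesis
    by (simp add: has_field_derivative_def)
qed

text \<open>The second difference of \<open>u\<close> over a small square at \<open>x\<close> does
  not depend on the order of the two directions, so a value of \<open>a2\<close> equals a value of
  \<open>b1\<close> at points near \<open>x\<close>. Continuity then excludes different values at
  \<open>x\<close>.\<close>

lemma mixed_partials_eq:
  fixes u a b a1 a2 b1 b2 :: "complex \<Rightarrow> real"
  assumes "open S" "x \<in> S"
    and u: "\<And>z. z \<in> S \<Longrightarrow> (u has_derivative (\<lambda>h. Re h * a z + Im h * b z)) (at z)"
    and a: "\<And>z. z \<in> S \<Longrightarrow> (a has_derivative (\<lambda>h. Re h * a1 z + Im h * a2 z)) (at z)"
    and b: "\<And>z. z \<in> S \<Longrightarrow> (b has_derivative (\<lambda>h. Re h * b1 z + Im h * b2 z)) (at z)"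
    and ca: "continuous_on S a2" and cb: "continuous_on S b1"
  shows "a2 x = b1 x"
proof (rule ccontr)
  assume ne: "a2 x \<noteq> b1 x"
  define e where "e = dist (a2 x) (b1 x) / 2"
  have "e > 0" using ne by (simp add: e_def)
  obtain r0 where r0: "r0 > 0" "ball x r0 \<subseteq> S"
    using assms(1,2) openE by blast
  have "continuous (at x) a2" "continuous (at x) b1"
    using ca cb assms(1,2) continuous_on_eq_continuous_at by blast+
  then obtain r1 r2 where r1: "r1 > 0" "\<And>y. dist y x < r1 \<Longrightarrow> dist (a2 y) (a2 x) < e"
    and r2: "r2 > 0" "\<And>y. dist y x < r2 \<Longrightarrow> dist (b1 y) (b1 x) < e"
    using \<open>e > 0\<close> unfolding continuous_at_eps_delta by metis
  \<comment> \<open>Points of the square lie within \<open>2 * h\<close> of \<open>x\<close>;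
    dividing by 3 keeps this strictly below all three radii.\<close>
  define h where "h = min r0 (min r1 r2) / 3"
  have h: "h > 0" "2 * h < r0" "2 * h < r1" "2 * h < r2"
    using r0 r1 r2 by (auto simp: h_def min_def)
  have near: "dist (x + s *\<^sub>R p + t *\<^sub>R q) x \<le> 2 * h"
    if "0 \<le> s" "s \<le> h" "0 \<le> t" "t \<le> h" "norm p = 1" "norm q = 1" for s t and p q :: complex
    using norm_triangle_ineq[of "s *\<^sub>R p" "t *\<^sub>R q"] that by (simp add: dist_norm add.assoc)
  have inS: "x + s *\<^sub>R p + t *\<^sub>R q \<in> S"
    if "0 \<le> s" "s \<le> h" "0 \<le> t" "t \<le> h" "norm p = 1" "norm q = 1" for s t and p q :: complex
    using near[OF that] r0(2) h(2) by (auto simp: dist_commute)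
  obtain s t where st: "0 < s" "s < h" "0 < t" "t < h"
    "u (x + h *\<^sub>R 1 + h *\<^sub>R \<i>) - u (x + h *\<^sub>R 1) - u (x + h *\<^sub>R \<i>) + u x
      = h * h * a2 (x + s *\<^sub>R 1 + t *\<^sub>R \<i>)"
  proof (rule second_difference_mvt[where u = u and A = a and B = a2 and p = 1 and q = \<i> and h = h and x = x])
    fix s t assume *: "0 \<le> s" "s \<le> h" "0 \<le> t" "t \<le> h"
    \<comment> \<open>The same point is needed in both orders of summation, because
      \<open>has_derivative_along_line\<close> varies the last summand.\<close>
    have S: "x + t *\<^sub>R \<i> + s *\<^sub>R 1 \<in> S" "x + s *\<^sub>R 1 + t *\<^sub>R \<i> \<in> S"
      using inS[OF *(3,4,1,2), of \<i> 1] inS[OF *, of 1 \<i>] by auto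
    show "((\<lambda>s. u (x + s *\<^sub>R 1 + t *\<^sub>R \<i>)) has_real_derivative a (x + s *\<^sub>R 1 + t *\<^sub>R \<i>)) (at s)"
      using has_derivative_along_line[OF u[OF S(1)]] by (simp add: algebra_simps)
    show "((\<lambda>t. a (x + s *\<^sub>R 1 + t *\<^sub>R \<i>)) has_real_derivative a2 (x + s *\<^sub>R 1 + t *\<^sub>R \<i>)) (at t)"
      using has_derivative_along_line[OF a[OF S(2)]] by simp
  qed (use h in auto)
  obtain s' t' where st': "0 < s'" "s' < h" "0 < t'" "t' < h"
    "u (x + h *\<^sub>R \<i> + h *\<^sub>R 1) - u (x + h *\<^sub>R \<i>) - u (x + h *\<^sub>R 1) + u x
      = h * h * b1 (x + s' *\<^sub>R \<i> + t' *\<^sub>R 1)"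
  proof (rule second_difference_mvt[where u = u and A = b and B = b1 and p = \<i> and q = 1 and h = h and x = x])
    fix s t assume *: "0 \<le> s" "s \<le> h" "0 \<le> t" "t \<le> h"
    have S: "x + t *\<^sub>R 1 + s *\<^sub>R \<i> \<in> S" "x + s *\<^sub>R \<i> + t *\<^sub>R 1 \<in> S"
      using inS[OF *(3,4,1,2), of 1 \<i>] inS[OF *, of \<i> 1] by auto
    show "((\<lambda>s. u (x + s *\<^sub>R \<i> + t *\<^sub>R 1)) has_real_derivative b (x + s *\<^sub>R \<i> + t *\<^sub>R 1)) (at s)"
      using has_derivative_along_line[OF u[OF S(1)]] by (simp add: algebra_simps)
    show "((\<lambda>t. b (x + s *\<^sub>R \<i> + t *\<^sub>R 1)) has_real_derivative b1 (x + s *\<^sub>R \<i> + t *\<^sub>R 1)) (at t)"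
      using has_derivative_along_line[OF b[OF S(2)]] by simp
  qed (use h in auto)
  have "x + h *\<^sub>R 1 + h *\<^sub>R \<i> = x + h *\<^sub>R \<i> + h *\<^sub>R 1" by simp
  with st(5) st'(5) have "h * h * a2 (x + s *\<^sub>R 1 + t *\<^sub>R \<i>) = h * h * b1 (x + s' *\<^sub>R \<i> + t' *\<^sub>R 1)"
    by (simp only: diff_right_commute)
  hence eq: "a2 (x + s *\<^sub>R 1 + t *\<^sub>R \<i>) = b1 (x + s' *\<^sub>R \<i> + t' *\<^sub>R 1)"
    using h by simp
  have "dist (a2 (x + s *\<^sub>R 1 + t *\<^sub>R \<i>)) (a2 x) < e"
    using near[of s t 1 \<i>] st h by (intro r1) auto
  moreover have "dist (b1 (x + s' *\<^sub>R \<i> + t' *\<^sub>R 1)) (b1 x) < e"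
    using near[of s' t' \<i> 1] st' h by (intro r2) auto
  ultimately show False
    using dist_triangle_half_r[of "b1 (x + s' *\<^sub>R \<i> + t' *\<^sub>R 1)" "a2 x" "dist (a2 x) (b1 x)" "b1 x"]
    unfolding eq e_def by simp
qed

section \<open>Holomorphy of the conjugate gradient\<close>

text \<open>For the function with real part u_x and imaginary part -u_y, one Cauchy-Riemann equation
  is the Laplace equation and the other is the symmetry of the mixed partials.\<close>

lemma harmonic_on_cnj_gradient_holomorphic:
  fixes G :: "complex \<Rightarrow> complex"
  assumes "harmonic_on S u"
    and G: "\<And>z. z \<in> S \<Longrightarrow> (u has_derivative (\<lambda>h. G z \<bullet> h)) (at z)"
  shows "(\<lambda>z. cnj (G z)) holomorphic_on S"
proof -
  from assms(1) obtain D :: "bool list \<Rightarrow> complex \<Rightarrow> real" where "open S"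
    and D0: "\<And>x. x \<in> S \<Longrightarrow> D [] x = u x"
    and Dc: "\<And>ds. length ds \<le> 2 \<Longrightarrow> continuous_on S (D ds)"
    and Dd: "\<And>ds x. length ds < 2 \<Longrightarrow> x \<in> S \<Longrightarrow>
      (D ds has_derivative (\<lambda>h. Re h *\<^sub>R D (True # ds) x + Im h *\<^sub>R D (False # ds) x)) (at x)"
    and lap: "\<And>x. x \<in> S \<Longrightarrow> D [True, True] x + D [False, False] x = 0"
    unfolding harmonic_on_def by blast
  \<comment> \<open>Harmonicity only supplies some family \<open>D\<close> of partials; uniqueness
    of the derivative, tested on 1 and \<open>\<i>\<close>, ties it to \<open>G\<close>.\<close>
  have G_eq: "cnj (G z) = Complex (D [True] z) (- D [False] z)" if "z \<in> S" for z
  proof -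
    have "(u has_derivative (\<lambda>h. Re h *\<^sub>R D [True] z + Im h *\<^sub>R D [False] z)) (at z)"
      by (rule has_derivative_transform_within_open[OF Dd[of "[]"] \<open>open S\<close>]) (use that D0 in auto)
    with G[OF that] have e: "(\<lambda>h. G z \<bullet> h) = (\<lambda>h. Re h *\<^sub>R D [True] z + Im h *\<^sub>R D [False] z)"
      by (rule has_derivative_unique)
    show ?thesis
      using fun_cong[OF e, of 1] fun_cong[OF e, of \<i>] by (simp add: inner_complex_def complex_eq_iff)
  qed
  have "((\<lambda>z. cnj (G z)) has_field_derivative
      Complex (D [True, True] z) (- D [True, False] z)) (at z)" if z: "z \<in> S" for z
  proof -
    have mixed: "D [False, True] z = D [True, False] z"
      by (rule mixed_partials_eq[OF \<open>open S\<close> z, of "D []" "D [True]" "D [False]"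
            "D [True, True]" _ _ "D [False, False]"])
        (use Dd Dc in auto)
    have lap': "D [False, False] z = - D [True, True] z"
      using lap[OF z] by simp
    have "((\<lambda>z. of_real (D [True] z) - \<i> * of_real (D [False] z)) has_derivative
       (\<lambda>h. of_real (Re h *\<^sub>R D [True, True] z + Im h *\<^sub>R D [False, True] z)
         - \<i> * of_real (Re h *\<^sub>R D [True, False] z + Im h *\<^sub>R D [False, False] z))) (at z)"
      using z by (intro has_derivative_diff has_derivative_mult_right has_derivative_of_real Dd) auto
    also have "(\<lambda>h. of_real (Re h *\<^sub>R D [True, True] z + Im h *\<^sub>R D [False, True] z)
         - \<i> * of_real (Re h *\<^sub>R D [True, False] z + Im h *\<^sub>R D [False, False] z))
       = (*) (Complex (D [True, True] z) (- D [True, False] z))"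
      using lap' mixed by (auto simp: complex_eq_iff mult.commute)
    finally show ?thesis
      unfolding has_field_derivative_def
      by (rule has_derivative_transform_within_open[OF _ \<open>open S\<close> z])
        (simp add: G_eq complex_eq_iff)
  qed
  thus ?thesis
    using \<open>open S\<close> by (subst holomorphic_on_open) blast+
qed

section \<open>Schwarz lemma estimates for positive harmonic functions\<close>

text \<open>The quotient is the Cayley map of the right half-plane onto the unit disc sending
  \<open>b\<close> to 0. Numerator and denominator have the same imaginary part, and their squared
  moduli differ by \<open>4 * Re a * Re b\<close>.\<close>

lemma positive_real_part_Schwarz:
  fixes a b :: complex
  assumes "Re a > 0" "Re b > 0"
  shows "norm ((a - b) / (a + cnj b)) < 1"
    and "r \<le> 1 \<Longrightarrow> norm ((a - b) / (a + cnj b)) \<le> r \<Longrightarrow> Re b * (1 - r) \<le> Re a * (1 + r)"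
proof -
  have ne: "a + cnj b \<noteq> 0" using assms by (auto simp: complex_eq_iff)
  have sq: "(norm (a + cnj b))\<^sup>2 = (Re a + Re b)\<^sup>2 + (Im a - Im b)\<^sup>2"
       "(norm (a - b))\<^sup>2 = (Re a - Re b)\<^sup>2 + (Im a - Im b)\<^sup>2"
    by (auto simp: cmod_power2)
  have "(Re a + Re b)\<^sup>2 - (Re a - Re b)\<^sup>2 = 4 * (Re a * Re b)"
    by (simp add: power2_eq_square algebra_simps)
  moreover have "Re a * Re b > 0" using assms by simp
  ultimately have "(norm (a - b))\<^sup>2 < (norm (a + cnj b))\<^sup>2"
    unfolding sq by linarith
  hence "norm (a - b) < norm (a + cnj b)" by (simp add: power_less_imp_less_base)
  thus "norm ((a - b) / (a + cnj b)) < 1"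
    using ne by (simp add: norm_divide)
  assume r: "r \<le> 1" "norm ((a - b) / (a + cnj b)) \<le> r"
  have r0: "0 \<le> r" using r(2) norm_ge_zero order_trans by blast
  have "norm (a - b) \<le> r * norm (a + cnj b)"
    using r ne by (simp add: norm_divide divide_le_eq)
  hence "(norm (a - b))\<^sup>2 \<le> r\<^sup>2 * (norm (a + cnj b))\<^sup>2"
    using power_mono[OF _ norm_ge_zero] by (metis power_mult_distrib)
  \<comment> \<open>The imaginary contribution is the same on both sides and drops out because its
    factor on the right is at most 1.\<close>
  moreover have "r\<^sup>2 * (Im a - Im b)\<^sup>2 \<le> (Im a - Im b)\<^sup>2"
    using r r0 by (intro mult_left_le_one_le) (auto simp: power_le_one)
  ultimately have "(Re a - Re b)\<^sup>2 \<le> (r * (Re a + Re b))\<^sup>2"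
    unfolding sq power_mult_distrib by (simp add: distrib_left)
  hence "\<bar>Re a - Re b\<bar> \<le> r * (Re a + Re b)"
    using r0 assms by (subst (asm) power2_le_iff_abs_le) auto
  thus "Re b * (1 - r) \<le> Re a * (1 + r)"
    by (simp add: algebra_simps abs_le_iff)
qed

text \<open>Both estimates are the Schwarz lemma for the Cayley transform
  \<open>(F - F z) / (F + cnj (F z))\<close>, where \<open>F\<close> is holomorphic with real part \<open>u\<close>.\<close>

lemma positive_harmonic_disc:
  fixes G :: "complex \<Rightarrow> complex"
  assumes "0 < d"
    and hol: "(\<lambda>w. cnj (G w)) holomorphic_on ball z d"
    and du: "\<And>w. w \<in> ball z d \<Longrightarrow> (u has_derivative (\<lambda>h. G w \<bullet> h)) (at w)"
    and pos: "\<And>w. w \<in> ball z d \<Longrightarrow> u w > 0"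
  shows positive_harmonic_gradient_bound: "norm (G z) * d \<le> 2 * u z"
    and positive_harmonic_Harnack:
      "norm v < 1 \<Longrightarrow> u z * (1 - norm v) \<le> u (z + d *\<^sub>R v) * (1 + norm v)"
proof -
  \<comment> \<open>A disc is convex, so the conjugate gradient has a primitive. Its real part has
    the same differential as \<open>u\<close>, and subtracting a constant makes the two
    equal.\<close>
  obtain F0 where F0: "\<And>w. w \<in> ball z d \<Longrightarrow> (F0 has_field_derivative cnj (G w)) (at w within ball z d)"
    using holomorphic_convex_primitive'[OF _ _ hol] by auto
  have F0': "(F0 has_field_derivative cnj (G w)) (at w)" if "w \<in> ball z d" for w
    using F0[OF that] that at_within_open[of w "ball z d"] by simp
  have Re0: "((\<lambda>w. Re (F0 w) - u w) has_derivative (\<lambda>h. 0)) (at w within ball z d)" if "w \<in> ball z d" for w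
  proof -
    have "((\<lambda>w. Re (F0 w) - u w) has_derivative (\<lambda>h. Re (cnj (G w) * h) - G w \<bullet> h)) (at w)"
      using F0'[OF that] du[OF that] unfolding has_field_derivative_def
      by (intro has_derivative_diff has_derivative_Re)
    also have "(\<lambda>h. Re (cnj (G w) * h) - G w \<bullet> h) = (\<lambda>h. 0)"
      by (auto simp: inner_complex_def)
    finally show ?thesis by (rule has_derivative_at_withinI)
  qed
  obtain c where c: "\<And>w. w \<in> ball z d \<Longrightarrow> Re (F0 w) - u w = c"
    using has_derivative_zero_constant[OF convex_ball Re0] by blast
  define F where "F = (\<lambda>w. F0 w - of_real c)"
  have ReF: "Re (F w) = u w" if "w \<in> ball z d" for w
    using c[OF that] by (simp add: F_def)
  have F': "(F has_field_derivative cnj (G w)) (at w)" if "w \<in> ball z d" for w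
    unfolding F_def using F0'[OF that] by (auto intro!: derivative_eq_intros)
  have zin: "z \<in> ball z d" using \<open>0 < d\<close> by simp
  have inb: "z + of_real d * v \<in> ball z d" if "norm v < 1" for v
    using that \<open>0 < d\<close> by (simp add: dist_norm norm_mult)
  define \<phi> where "\<phi> v = (F (z + of_real d * v) - F z) / (F (z + of_real d * v) + cnj (F z))" for v
  have ne: "F (z + of_real d * v) + cnj (F z) \<noteq> 0" if "norm v < 1" for v
    using ReF[OF inb[OF that]] pos[OF inb[OF that]] ReF[OF zin] pos[OF zin] by (auto simp: complex_eq_iff)
  have dF: "((\<lambda>v. F (z + of_real d * v)) has_field_derivative cnj (G (z + of_real d * v)) * of_real d) (at v)"
    if "norm v < 1" for v
    by (rule DERIV_chain2[where f = F and g = "\<lambda>v. z + of_real d * v", OF F'[OF inb[OF that]]]) (auto intro!: derivative_eq_intros)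
  have "(\<lambda>v. F (z + of_real d * v)) holomorphic_on ball 0 1"
    by (subst holomorphic_on_open) (use dF mem_ball_0 in blast)+
  hence "\<phi> holomorphic_on ball 0 1"
    unfolding \<phi>_def
    by (intro holomorphic_intros) (use ne in auto)
  moreover have "\<phi> 0 = 0" by (simp add: \<phi>_def)
  moreover have "norm (\<phi> v) < 1" if "norm v < 1" for v
    unfolding \<phi>_def using ReF[OF inb[OF that]] pos[OF inb[OF that]] ReF[OF zin] pos[OF zin]
    by (intro positive_real_part_Schwarz) auto
  ultimately have Schwarz: "\<And>v. norm v < 1 \<Longrightarrow> norm (\<phi> v) \<le> norm v" "norm (deriv \<phi> 0) \<le> 1"
    using Schwarz_Lemma(1,2)[of \<phi>] norm_zero zero_less_one by metis+
  show "u z * (1 - norm v) \<le> u (z + d *\<^sub>R v) * (1 + norm v)" if v: "norm v < 1"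
    using positive_real_part_Schwarz(2)[of "F (z + of_real d * v)" "F z" "norm v"]
      Schwarz(1)[OF v] v ReF[OF inb[OF v]] pos[OF inb[OF v]] ReF[OF zin] pos[OF zin]
    by (simp add: \<phi>_def scaleR_conv_of_real)
  \<comment> \<open>The numerator of \<open>\<phi>\<close> vanishes at 0, so only its derivative
    divided by this denominator survives in the derivative of \<open>\<phi>\<close> at 0.\<close>
  have Fz: "F z + cnj (F z) = of_real (2 * u z)"
    using ReF[OF zin] by (simp add: complex_add_cnj)
  have "(\<phi> has_field_derivative (cnj (G z) * of_real d) / of_real (2 * u z)) (at 0)"
    unfolding \<phi>_def
    by (rule derivative_eq_intros dF[of 0, simplified] refl)+
      (use ne[of 0] Fz pos[OF zin] in \<open>auto simp: field_simps\<close>)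
  hence "deriv \<phi> 0 = (cnj (G z) * of_real d) / of_real (2 * u z)"
    by (rule DERIV_imp_deriv)
  hence "norm (deriv \<phi> 0) = norm (G z) * d / (2 * u z)"
    using \<open>0 < d\<close> pos[OF zin] by (simp add: norm_divide norm_mult)
  with Schwarz(2) show "norm (G z) * d \<le> 2 * u z"
    using pos[OF zin] by (simp add: divide_le_eq)
qed

section \<open>Exterior points and discs touching the boundary\<close>

text \<open>A boundary chart sends the domain to the upper side and its frontier to the real axis,
  so the preimage of a point just below the axis is exterior.\<close>

lemma smooth_domain_exterior_point:
  assumes "smooth_domain \<Omega>"
  obtains p where "p \<notin> closure \<Omega>"
proof -
  from assms obtain z0 where z0: "z0 \<in> frontier \<Omega>"
    unfolding smooth_domain_def by auto
  with assms obtain \<epsilon> \<psi> D where "\<epsilon> > 0" and diffeo: "smooth_diffeo (ball z0 \<epsilon>) \<psi> D"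
    and up: "\<psi> ` (ball z0 \<epsilon> \<inter> \<Omega>) = D \<inter> {x. Im x > 0}"
    and flat: "\<psi> ` (ball z0 \<epsilon> \<inter> frontier \<Omega>) = D \<inter> {x. Im x = 0}"
    unfolding smooth_domain_def by metis
  have bij: "bij_betw \<psi> (ball z0 \<epsilon>) D" and "open D"
    using diffeo by (auto simp: smooth_diffeo_def)
  have "\<psi> z0 \<in> D \<inter> {x. Im x = 0}"
    unfolding flat[symmetric] using z0 \<open>\<epsilon> > 0\<close> by simp
  hence y0: "\<psi> z0 \<in> D" "Im (\<psi> z0) = 0" by auto
  obtain r where r: "r > 0" "ball (\<psi> z0) r \<subseteq> D"
    using \<open>open D\<close> y0 openE by blast
  define y where "y = \<psi> z0 - of_real (r / 2) * \<i>"
  have "y \<in> D" "Im y < 0"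
    using r y0 by (auto simp: y_def dist_norm norm_mult subset_iff)
  then obtain p where p: "p \<in> ball z0 \<epsilon>" "\<psi> p = y"
    using bij by (metis bij_betw_def imageE)
  have "p \<notin> \<Omega>"
  proof
    assume "p \<in> \<Omega>"
    hence "\<psi> p \<in> D \<inter> {x. Im x > 0}"
      unfolding up[symmetric] using p(1) by blast
    with p \<open>Im y < 0\<close> show False by simp
  qed
  moreover have "p \<notin> frontier \<Omega>"
  proof
    assume "p \<in> frontier \<Omega>"
    hence "\<psi> p \<in> D \<inter> {x. Im x = 0}"
      unfolding flat[symmetric] using p(1) by blast
    with p \<open>Im y < 0\<close> show False by simp
  qed
  ultimately have "p \<notin> closure \<Omega>"
    by (simp add: closure_Un_frontier)
  thus ?thesis by (rule that)
qed

text \<open>The radius is the distance from \<open>z\<close> to the frontier, attained since the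
  frontier is closed. A ball of this radius leaving \<open>\<Omega>\<close> would, being connected,
  contain a frontier point closer to \<open>z\<close>.\<close>

lemma maximal_ball_touching_frontier:
  fixes \<Omega> :: "'a::euclidean_space set"
  assumes "open \<Omega>" "frontier \<Omega> \<noteq> {}" "z \<in> \<Omega>"
  obtains d p where "d > 0" "p \<in> frontier \<Omega>" "dist z p = d" "ball z d \<subseteq> \<Omega>"
proof -
  obtain p where p: "p \<in> frontier \<Omega>" "infdist z (frontier \<Omega>) = dist z p"
    using infdist_attains_inf[OF frontier_closed assms(2)] by blast
  have "z \<notin> frontier \<Omega>"
    using assms by (simp add: frontier_def interior_open)
  hence "dist z p > 0" using p by auto
  moreover have "ball z (dist z p) \<subseteq> \<Omega>"
  proof (rule ccontr)
    assume "\<not> ?thesis"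
    then obtain q where q: "q \<in> ball z (dist z p)" "q \<in> frontier \<Omega>"
      using connected_Int_frontier[of "ball z (dist z p)" \<Omega>] \<open>dist z p > 0\<close> assms(3)
      by (metis Diff_eq_empty_iff IntI Int_emptyI centre_in_ball connected_ball empty_iff)
    have "infdist z (frontier \<Omega>) \<le> dist z q" by (rule infdist_le[OF q(2)])
    with q p show False by simp
  qed
  ultimately show ?thesis using p that by blast
qed

section \<open>The gradient bound by comparison at a touching point\<close>

text \<open>At the point \<open>p\<close> where the largest disc around \<open>z\<close> touches the boundary, Harnack's
  inequality bounds the normal derivative of \<open>u\<close> from below by \<open>u z / (2 * d)\<close>; as that
  derivative is at most 1, \<open>u z \<le> 2 * d\<close>.\<close>

lemma gradient_le_4:
  fixes G :: "complex \<Rightarrow> complex"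
  assumes "open \<Omega>" "frontier \<Omega> \<noteq> {}"
    and hol: "(\<lambda>w. cnj (G w)) holomorphic_on \<Omega>"
    and cu: "continuous_on (closure \<Omega>) u" and cG: "continuous_on (closure \<Omega>) G"
    and du: "\<And>w. w \<in> \<Omega> \<Longrightarrow> (u has_derivative (\<lambda>h. G w \<bullet> h)) (at w)"
    and pos: "\<And>w. w \<in> \<Omega> \<Longrightarrow> u w > 0"
    and bd: "\<And>w. w \<in> frontier \<Omega> \<Longrightarrow> u w = 0" "\<And>w. w \<in> frontier \<Omega> \<Longrightarrow> norm (G w) \<le> 1"
    and z: "z \<in> \<Omega>"
  shows "norm (G z) \<le> 4"
proof -
  obtain d p where dp: "d > 0" "p \<in> frontier \<Omega>" "dist z p = d" "ball z d \<subseteq> \<Omega>"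
    using maximal_ball_touching_frontier[OF assms(1,2) z] by blast
  have disc: "(\<lambda>w. cnj (G w)) holomorphic_on ball z d"
      "\<And>w. w \<in> ball z d \<Longrightarrow> (u has_derivative (\<lambda>h. G w \<bullet> h)) (at w)"
      "\<And>w. w \<in> ball z d \<Longrightarrow> u w > 0"
    using hol du pos dp(4) by (auto intro: holomorphic_on_subset)
  \<comment> \<open>The radius from the contact point \<open>p\<close> at \<open>t = 0\<close> to
    the centre \<open>z\<close> at \<open>t = 1\<close>; \<open>\<gamma>_alt\<close> puts it in the
    form required by Harnack's inequality, with a vector of norm \<open>1 - t\<close>.\<close>
  define \<gamma> where "\<gamma> t = p + t *\<^sub>R (z - p)" for t :: real
  have npz: "norm (z - p) = d" using dp(3) by (simp add: dist_norm)
  have \<gamma>_alt: "\<gamma> t = z + d *\<^sub>R (((1 - t) / d) *\<^sub>R (p - z))" for t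
    using dp(1) by (simp add: \<gamma>_def) (simp add: algebra_simps)
  have n_v: "norm (((1 - t) / d) *\<^sub>R (p - z)) = 1 - t" if "t \<le> 1" for t
    using that dp(1) npz by (simp add: norm_minus_commute)
  have \<gamma>_in: "\<gamma> t \<in> ball z d" if "0 < t" "t \<le> 1" for t
  proof -
    have "dist z (\<gamma> t) = d * (1 - t)"
      unfolding \<gamma>_alt dist_norm using n_v[OF that(2)] dp(1) by (simp del: scaleR_scaleR)
    also have "\<dots> < d" using that dp(1) by simp
    finally show ?thesis by simp
  qed
  have \<gamma>_cl: "\<gamma> t \<in> closure \<Omega>" if "0 \<le> t" "t \<le> 1" for t
  proof (cases "t = 0")
    case True
    thus ?thesis using dp(2) by (simp add: \<gamma>_def frontier_def)
  next
    case False
    thus ?thesis using \<gamma>_in[of t] that dp(4) closure_subset by force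
  qed
  have c\<gamma>: "continuous_on {0..1} \<gamma>"
    unfolding \<gamma>_def by (intro continuous_intros)
  have \<gamma>_img: "\<gamma> ` {0..1} \<subseteq> closure \<Omega>" using \<gamma>_cl by auto
  have c1: "continuous_on {0..1} (\<lambda>t. u (\<gamma> t))"
    by (rule continuous_on_compose2[OF cu c\<gamma> \<gamma>_img])
  have c2: "continuous_on {0..1} (\<lambda>t. norm (G (\<gamma> t)))"
    by (intro continuous_on_norm continuous_on_compose2[OF cG c\<gamma> \<gamma>_img])
  \<comment> \<open>The mean value theorem bounds \<open>u (\<gamma> t)\<close> above by
    \<open>t * d\<close> times the gradient norm at some \<open>\<gamma> s\<close>, Harnack bounds
    it below by \<open>t * u z / 2\<close>, and \<open>t\<close> cancels. Differentiability is used
    only at interior points of the segment.\<close>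
  have lower: "\<exists>s. 0 < s \<and> s < t \<and> u z \<le> 2 * d * norm (G (\<gamma> s))" if t: "0 < t" "t \<le> 1" for t
  proof -
    have "continuous_on {0..t} (\<lambda>t. u (\<gamma> t))"
      using continuous_on_subset[OF c1] t by auto
    moreover have "((\<lambda>t. u (\<gamma> t)) has_derivative (\<lambda>h. G (\<gamma> s) \<bullet> (h *\<^sub>R (z - p)))) (at s)"
      if s: "0 < s" "s < t" for s
    proof (rule has_derivative_compose[where g = u and g' = "(\<bullet>) (G (\<gamma> s))"])
      show "(\<gamma> has_derivative (\<lambda>h. h *\<^sub>R (z - p))) (at s)"
        unfolding \<gamma>_def by (auto intro!: derivative_eq_intros)
      show "(u has_derivative (\<bullet>) (G (\<gamma> s))) (at (\<gamma> s))"
        using s t \<gamma>_in[of s] by (intro disc) auto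
    qed
    ultimately obtain s where s: "0 < s" "s < t"
      and "u (\<gamma> t) - u (\<gamma> 0) = G (\<gamma> s) \<bullet> ((t - 0) *\<^sub>R (z - p))"
      by (rule mvt[OF t(1)])
    hence "u (\<gamma> t) = t * (G (\<gamma> s) \<bullet> (z - p))"
      using bd(1)[OF dp(2)] by (simp add: \<gamma>_def)
    also have "\<dots> \<le> t * (norm (G (\<gamma> s)) * d)"
      using norm_cauchy_schwarz[of "G (\<gamma> s)" "z - p"] t by (simp add: npz)
    finally have up: "u (\<gamma> t) \<le> t * (norm (G (\<gamma> s)) * d)" .
    have "u z * (1 - (1 - t)) \<le> u (\<gamma> t) * (1 + (1 - t))"
      using positive_harmonic_Harnack[OF dp(1) disc, of "((1 - t) / d) *\<^sub>R (p - z)"] t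
      unfolding n_v[OF t(2)] \<gamma>_alt[symmetric] by simp
    also have "\<dots> \<le> u (\<gamma> t) * 2"
      using disc(3)[OF \<gamma>_in[OF t]] t by (intro mult_left_mono) auto
    finally have "t * u z \<le> t * (2 * d * norm (G (\<gamma> s)))"
      using up by (simp add: algebra_simps)
    with s t show ?thesis by auto
  qed
  \<comment> \<open>For small \<open>t\<close> the point \<open>\<gamma> s\<close> is close to
    \<open>p\<close>, where the gradient has norm at most 1, and \<open>G\<close> is continuous up
    to the boundary.\<close>
  have near: "u z \<le> 2 * d * (1 + e)" if "e > 0" for e
  proof -
    obtain \<delta> where \<delta>: "\<delta> > 0" "\<And>t. t \<in> {0..1} \<Longrightarrow> dist t 0 < \<delta> \<Longrightarrow> dist (norm (G (\<gamma> t))) (norm (G (\<gamma> 0))) < e"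
      using c2 \<open>e > 0\<close> unfolding continuous_on_iff by (metis atLeastAtMost_iff order_refl zero_le_one)
    obtain s where s: "0 < s" "s < min 1 \<delta>" "u z \<le> 2 * d * norm (G (\<gamma> s))"
      using lower[of "min 1 \<delta>"] \<delta>(1) by auto
    have "norm (G (\<gamma> s)) \<le> 1 + e"
      using \<delta>(2)[of s] s bd(2)[OF dp(2)] by (auto simp: dist_real_def \<gamma>_def)
    hence "2 * d * norm (G (\<gamma> s)) \<le> 2 * d * (1 + e)"
      using dp(1) by simp
    with s(3) show ?thesis by linarith
  qed
  have "u z \<le> 2 * d + e" if "e > 0" for e
    using near[of "e / (2 * d)"] dp(1) that by (simp add: distrib_left)
  hence "u z \<le> 2 * d" by (rule field_le_epsilon)
  moreover have "norm (G z) * d \<le> 2 * u z"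
    by (rule positive_harmonic_gradient_bound[OF dp(1) disc])
  ultimately have "norm (G z) * d \<le> 4 * d" by linarith
  thus ?thesis using dp(1) by simp
qed

section \<open>A Phragmen-Lindelof principle\<close>

text \<open>The factor \<open>1 / (w - p)\<close> makes \<open>f ^ n\<close> vanish at infinity; its influence disappears
  after taking \<open>n\<close>-th roots.\<close>

lemma Phragmen_Lindelof_exterior_point:
  fixes f :: "complex \<Rightarrow> complex"
  assumes "open \<Omega>" "p \<notin> closure \<Omega>"
    and hol: "f holomorphic_on \<Omega>" and cont: "continuous_on (closure \<Omega>) f"
    and M: "\<And>w. w \<in> \<Omega> \<Longrightarrow> norm (f w) \<le> M"
    and fr: "\<And>w. w \<in> frontier \<Omega> \<Longrightarrow> norm (f w) \<le> 1"
    and z: "z \<in> \<Omega>"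
  shows "norm (f z) \<le> 1"
proof -
  obtain \<delta> where \<delta>: "\<delta> > 0" "\<And>w. w \<in> closure \<Omega> \<Longrightarrow> \<delta> \<le> dist p w"
    using separate_point_closed[OF closed_closure assms(2)] by blast
  have pz: "norm (z - p) > 0" using assms(2) z closure_subset by fastforce
  have "norm (f z) ^ n \<le> norm (z - p) / \<delta>" for n
  proof -
    \<comment> \<open>The first entry puts \<open>z\<close> inside the disc; the second makes
      \<open>M ^ n / R\<close> at most \<open>1 / \<delta>\<close> on the circle.\<close>
    define R where "R = max (norm (z - p) + 1) (M ^ n * \<delta>)"
    define S where "S = \<Omega> \<inter> ball p R"
    define g where "g w = f w ^ n / (w - p)" for w
    have "R > 0" using pz unfolding R_def by linarith
    have "open S" using assms(1) by (auto simp: S_def)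
    have clS: "closure S \<subseteq> closure \<Omega>" "closure S \<subseteq> cball p R"
      by (simp add: S_def closure_mono, rule closure_minimal) (auto simp: S_def)
    have ne: "w - p \<noteq> 0" if "w \<in> closure \<Omega>" for w
      using that assms(2) by auto
    have "g holomorphic_on interior S"
      unfolding g_def using hol ne closure_subset[of \<Omega>] \<open>open S\<close>
      unfolding interior_open[OF \<open>open S\<close>]
      by (intro holomorphic_intros holomorphic_on_subset[OF hol]) (auto simp: S_def)
    moreover have "continuous_on (closure S) g"
      unfolding g_def using clS(1) ne
      by (intro continuous_intros continuous_on_subset[OF cont]) auto
    moreover have "bounded S" by (simp add: S_def bounded_Int)
    moreover have "norm (g w) \<le> 1 / \<delta>" if w: "w \<in> frontier S" for w
    proof -
      have wcl: "w \<in> closure \<Omega>" "dist p w \<le> R" "w \<notin> S"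
        using w clS \<open>open S\<close> by (auto simp: frontier_def interior_open)
      have d: "\<delta> \<le> norm (w - p)" using \<delta>(2)[OF wcl(1)] by (simp add: dist_norm norm_minus_commute)
      \<comment> \<open>A frontier point of \<open>S\<close> inside \<open>\<Omega>\<close> lies on
        the circle, where the choice of \<open>R\<close> helps; otherwise it is a frontier point of
        \<open>\<Omega>\<close>, where \<open>f\<close> has modulus at most 1 and \<open>w\<close>
        is at distance at least \<open>\<delta>\<close> from \<open>p\<close>.\<close>
      show ?thesis
      proof (cases "w \<in> \<Omega>")
        case True
        hence R: "norm (w - p) = R" using wcl by (simp add: S_def dist_norm norm_minus_commute)
        have "norm (f w) ^ n * \<delta> \<le> M ^ n * \<delta>"
          using M[OF True] \<delta>(1) by (intro mult_right_mono power_mono) auto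
        also have "\<dots> \<le> R" by (simp add: R_def)
        finally show ?thesis
          using \<open>R > 0\<close> \<delta>(1) by (simp add: g_def norm_divide norm_power R field_simps)
      next
        case False
        hence "norm (f w) ^ n \<le> 1"
          using wcl assms(1) by (intro power_le_one fr) (auto simp: frontier_def interior_open)
        thus ?thesis
          unfolding g_def norm_divide norm_power using d \<delta>(1) by (intro frac_le) auto
      qed
    qed
    moreover have "z \<in> S"
      using z by (auto simp: S_def R_def dist_norm norm_minus_commute)
    ultimately have "norm (g z) \<le> 1 / \<delta>"
      by (rule maximum_modulus_frontier)
    thus ?thesis
      using pz \<delta>(1) by (simp add: g_def norm_divide norm_power field_simps)
  qed
  \<comment> \<open>The bound on the powers does not depend on \<open>n\<close>, whereas the powers
    of a number above 1 are unbounded.\<close>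
  thus ?thesis
    using real_arch_pow[of "norm (f z)" "norm (z - p) / \<delta>"] by (meson not_le)
qed

section \<open>The equality case and the conclusion\<close>

lemma connected_subset_eq_if_frontier_disjoint:
  assumes "connected H" "\<Omega> \<subseteq> H" "\<Omega> \<noteq> {}" "frontier \<Omega> \<inter> H = {}"
  shows "\<Omega> = H"
  using connected_Int_frontier[of H \<Omega>] assms by blast

text \<open>Here \<open>u\<close> is affine, by continuity also on the closure. Positivity puts
  \<open>\<Omega>\<close> inside the half-plane where the affine function is positive, and its zeros
  on the frontier keep the frontier out of that connected half-plane, so the two sets agree.\<close>

lemma half_plane_if_constant_gradient:
  assumes "open \<Omega>" "connected \<Omega>" "z \<in> \<Omega>" "b \<noteq> 0"
    and du: "\<And>w. w \<in> \<Omega> \<Longrightarrow> (u has_derivative (\<lambda>h. b \<bullet> h)) (at w)"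
    and cu: "continuous_on (closure \<Omega>) u"
    and pos: "\<And>w. w \<in> \<Omega> \<Longrightarrow> u w > 0"
    and bd: "\<And>w. w \<in> frontier \<Omega> \<Longrightarrow> u w = 0"
  shows "half_plane \<Omega>"
proof -
  have "((\<lambda>w. u w - b \<bullet> w) has_derivative (\<lambda>h. 0)) (at w)" if "w \<in> \<Omega>" for w
    using has_derivative_diff[OF du[OF that] has_derivative_inner_right[OF has_derivative_ident, of b]]
    by simp
  note const = has_derivative_zero_unique_connected[OF assms(1,2) this]
  define k where "k = u z - b \<bullet> z"
  have k: "u w - b \<bullet> w = k" if "w \<in> \<Omega>" for w
    unfolding k_def by (rule const[OF _ that assms(3)])
  have kc: "u w - b \<bullet> w = k" if "w \<in> closure \<Omega>" for w
    by (rule continuous_constant_on_closure[of \<Omega> "\<lambda>w. u w - b \<bullet> w" k w])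
      (use cu k that in \<open>auto intro!: continuous_intros\<close>)
  have "\<Omega> = {w. b \<bullet> w > - k}"
  proof (rule connected_subset_eq_if_frontier_disjoint)
    show "connected {w. b \<bullet> w > - k}"
      by (intro convex_connected convex_halfspace_gt)
    show "\<Omega> \<subseteq> {w. b \<bullet> w > - k}"
      using k pos by force
    show "frontier \<Omega> \<inter> {w. b \<bullet> w > - k} = {}"
      using kc bd by (force simp: frontier_def)
  qed (use assms(3) in auto)
  thus ?thesis
    using assms(4) unfolding half_plane_def by blast
qed

theorem mainTheorem3:
  fixes \<Omega> :: "complex set" and u :: "complex \<Rightarrow> real"
  assumes "exceptional_domain \<Omega>"
    and "finite (components (frontier \<Omega>))"
    and "\<not> half_plane \<Omega>"
    and "associated_function \<Omega> u"
  shows "\<forall>z\<in>\<Omega>. \<forall>g. (u has_derivative (\<lambda>h. g \<bullet> h)) (at z) \<longrightarrow> norm g < 1"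
proof -
  have \<Omega>: "open \<Omega>" "connected \<Omega>" "frontier \<Omega> \<noteq> {}" "smooth_domain \<Omega>"
    using assms(1) by (auto simp: exceptional_domain_def smooth_domain_def)
  from assms(4) obtain G :: "complex \<Rightarrow> complex"
    where harm: "harmonic_on \<Omega> u" and cu: "continuous_on (closure \<Omega>) u"
      and cG: "continuous_on (closure \<Omega>) G"
      and du: "\<And>z. z \<in> \<Omega> \<Longrightarrow> (u has_derivative (\<lambda>h. G z \<bullet> h)) (at z)"
      and G1: "\<And>z. z \<in> frontier \<Omega> \<Longrightarrow> norm (G z) = 1"
      and pos: "\<And>z. z \<in> \<Omega> \<Longrightarrow> u z > 0" and bd: "\<And>z. z \<in> frontier \<Omega> \<Longrightarrow> u z = 0"
    unfolding associated_function_def by blast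
  have hol: "(\<lambda>z. cnj (G z)) holomorphic_on \<Omega>"
    by (rule harmonic_on_cnj_gradient_holomorphic[OF harm du])
  have bound: "norm (G z) \<le> 4" if "z \<in> \<Omega>" for z
    by (rule gradient_le_4[OF \<Omega>(1,3) hol cu cG du pos bd _ that]) (simp_all add: G1)
  obtain p where p: "p \<notin> closure \<Omega>"
    using smooth_domain_exterior_point[OF \<Omega>(4)] by blast
  have cf: "continuous_on (closure \<Omega>) (\<lambda>z. cnj (G z))"
    by (intro continuous_intros cG)
  have le1: "norm (G z) \<le> 1" if "z \<in> \<Omega>" for z
    using Phragmen_Lindelof_exterior_point[OF \<Omega>(1) p hol cf _ _ that, of 4] bound G1 by simp
  have "norm (G z) \<noteq> 1" if z: "z \<in> \<Omega>" for z
  proof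
    assume eq: "norm (G z) = 1"
    \<comment> \<open>An interior point where the modulus reaches its upper bound 1 forces the
      holomorphic function to be constant.\<close>
    have "(\<lambda>z. cnj (G z)) constant_on \<Omega>"
      by (rule maximum_modulus_principle[OF hol \<Omega>(1,2,1) order_refl z]) (use le1 eq in simp)
    hence const: "G w = G z" if "w \<in> \<Omega>" for w
      using that z unfolding constant_on_def by (metis complex_cnj_cancel_iff)
    have "half_plane \<Omega>"
    proof (rule half_plane_if_constant_gradient[OF \<Omega>(1,2) z _ _ cu pos bd])
      show "G z \<noteq> 0" using eq by auto
      show "(u has_derivative (\<bullet>) (G z)) (at w)" if "w \<in> \<Omega>" for w
        using du[OF that] const[OF that] by simp
    qed
    with assms(3) show False by simp
  qed
  with le1 have lt1: "norm (G z) < 1" if "z \<in> \<Omega>" for z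
    using that by (simp add: order_less_le)
  show ?thesis
  proof (intro ballI allI impI)
    \<comment> \<open>The conclusion concerns any vector representing the derivative; uniqueness
      identifies it with \<open>G z\<close>.\<close>
    fix z g assume z: "z \<in> \<Omega>" and "(u has_derivative (\<lambda>h. g \<bullet> h)) (at z)"
    hence "(\<lambda>h. g \<bullet> h) = (\<lambda>h. G z \<bullet> h)"
      using du[OF z] has_derivative_unique by blast
    hence "g = G z" by (metis vector_eq_rdot)
    thus "norm g < 1" using lt1[OF z] by simp
  qed
qed

end
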